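(* Let $X^0$ be one of the four diffusions listed in the context, with left boundary $\ell$, let $\ell\le a<b$, and define $$\beta=\frac{\frac{P}{\varphi(\ell)}+e^{-\alpha\Delta}\left[R(F(b);a)-H(F(b))\varphi(a)\frac{P}{\varphi(\ell)}\right]}{F(b)-F(\ell)-e^{-\alpha\Delta}(F(a)-F(\ell))H(F(b))\varphi(a)},\qquad \xi=-\beta F(\ell)-\frac{P}{\varphi(\ell)}.$$ Let $W(y)=\beta y+\xi$ for $y\in[F(\ell),F(b)]$ and $$W(y)=e^{-\alpha\Delta}\left[W(F(a))\,\varphi(a)\,H(y)+R(y;a)\right],\qquad y\ge F(b).$$ Suppose that $b$ satisfies $$\beta = e^{-\alpha\Delta}\left[\frac{\partial}{\partial y}R(y;a)\Big|_{y=F(b)} + H'(F(b))\,\varphi(a)\left(\beta\,(F(a)-F(\ell))-\frac{P}{\varphi(\ell)}\right)\right].$$ Then the left and the right derivatives of $W$ at $F(b)$ are both equal to $\beta$; that is, smooth fit holds at $F(b)$.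
   Context: Model. $W$ (in the stochastic differential equations below only) denotes a standard Brownian motion, written $(B_t)$ here to avoid confusion with the function $W$ of the claim. $X^0$, with $X^0_0=x$, is one of: (i) Brownian motion with drift $dX^0_t=\mu\,dt+\sigma\,dB_t$, $\mu,\sigma>0$; (ii) Ornstein-Uhlenbeck $dX^0_t=-\rho X^0_t\,dt+dB_t$, $\rho>0$; (iii) square-root process $dX^0_t=(1-2\rho X^0_t)\,dt+2\sqrt{X^0_t}\,dB_t$, $\rho>0$; (iv) geometric Brownian motion $dX^0_t=\mu X^0_t\,dt+\sigma X^0_t\,dB_t$. The ruin level is $\ell=0$ in cases (i)-(iii) and $\ell=d$ for a fixed $d>0$ in case (iv); the state space is $[\ell,\infty)$ and $\tau_\ell=\inf\{t\ge0: X^0_t\le \ell\}$. $\mathbb{E}^x,\mathbb{P}^x$ refer to $X^0_0=x$. Constants: discount rate $\alpha>0$, delay $\Delta\ge0$, fixed transaction cost $\lambda>0$, ruin penalty $P\ge 0$ ($P=0$ except possibly in case (ii)). Fundamental solutions. $\mathcal{A}$ is the infinitesimal generator of $X^0$; $\psi$ and $\varphi$ are the positive strictly increasing, respectively strictly decreasing, solutions of $(\mathcal{A}-\alpha)u=0$ (determined up to multiplicative constants), and $F=\psi/\varphi$, a strictly increasing function with inverse $F^{-1}$. Functions. For $x\ge \ell$, $$h(x)=\mathbb{P}^x(\Delta<\tau_\ell),\qquad r(x;a)=\mathbb{E}^x\left[1_{\{\Delta<\tau_\ell\}}(X^0_\Delta-a-\lambda)\right]-e^{\alpha\Delta}P\,\mathbb{E}^x\left[1_{\{\Delta>\tau_\ell\}}e^{-\alpha\tau_\ell}\right],$$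 and $$R(\cdot;a)=\frac{r(F^{-1}(\cdot);a)}{\varphi(F^{-1}(\cdot))},\qquad H(\cdot)=\frac{h(F^{-1}(\cdot))}{\varphi(F^{-1}(\cdot))}.$$ *)

theory Defs
  imports "HOL-Probability.Probability"
begin

section \<open>Brownian motion and stochastic differential equations\<close>

definition brownian_motion ::
  "'w measure \<Rightarrow> (real \<Rightarrow> 'w measure) \<Rightarrow> (real \<Rightarrow> 'w \<Rightarrow> real) \<Rightarrow> bool" where
  "brownian_motion M Fi B \<longleftrightarrow>
     prob_space M \<and> filtration (space M) Fi \<and> (\<forall>t. sets (Fi t) \<subseteq> sets M) \<and>
     (\<forall>t\<ge>0. B t \<in> borel_measurable (Fi t)) \<and>
     (\<forall>\<omega>\<in>space M. B 0 \<omega> = 0 \<and> continuous_on {0..} (\<lambda>t. B t \<omega>)) \<and>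
     (\<forall>s t. 0 \<le> s \<and> s < t \<longrightarrow>
        distributed M lborel (\<lambda>\<omega>. B t \<omega> - B s \<omega>)
          (\<lambda>x. ennreal (normal_density 0 (sqrt (t - s)) x)) \<and>
        prob_space.indep_set M (sets (Fi s))
          (sets (vimage_algebra (space M) (\<lambda>\<omega>. B t \<omega> - B s \<omega>) borel)))"

definition tendsto_in_probability ::
  "'w measure \<Rightarrow> (nat \<Rightarrow> 'w \<Rightarrow> real) \<Rightarrow> ('w \<Rightarrow> real) \<Rightarrow> bool" where
  "tendsto_in_probability M S Z \<longleftrightarrow>
     (\<forall>n. S n \<in> borel_measurable M) \<and> Z \<in> borel_measurable M \<and>
     (\<forall>\<epsilon>>0. (\<lambda>n. measure M {\<omega> \<in> space M. \<epsilon> < \<bar>S n \<omega> - Z \<omega>\<bar>}) \<longlonglongrightarrow> 0)"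

text \<open>\<open>Z\<close> is (a version of) the Ito integral of \<open>H\<close> against \<open>B\<close> over \<open>[0, t]\<close>. It is used only for
  adapted integrands with continuous paths; for these the Ito integral is the limit in probability
  of the left-endpoint Riemann sums along any partitions with vanishing mesh.\<close>

definition ito_integral ::
  "'w measure \<Rightarrow> (real \<Rightarrow> 'w \<Rightarrow> real) \<Rightarrow> (real \<Rightarrow> 'w \<Rightarrow> real) \<Rightarrow> real \<Rightarrow> ('w \<Rightarrow> real) \<Rightarrow> bool" where
  "ito_integral M H B t Z \<longleftrightarrow>
     tendsto_in_probability M
       (\<lambda>n \<omega>. \<Sum>k<n. H (real k * t / real n) \<omega> *
          (B (real (Suc k) * t / real n) \<omega> - B (real k * t / real n) \<omega>)) Z"

text \<open>\<open>X\<close> is a (weak) solution, with values in the interval \<open>I\<close>, of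
  \<open>dX = m(X) dt + v(X) dB\<close>, \<open>X 0 = x\<close>.\<close>

definition sde_solution ::
  "real set \<Rightarrow> (real \<Rightarrow> real) \<Rightarrow> (real \<Rightarrow> real) \<Rightarrow> real \<Rightarrow>
   'w measure \<Rightarrow> (real \<Rightarrow> 'w measure) \<Rightarrow> (real \<Rightarrow> 'w \<Rightarrow> real) \<Rightarrow> (real \<Rightarrow> 'w \<Rightarrow> real) \<Rightarrow> bool" where
  "sde_solution I m v x M Fi B X \<longleftrightarrow>
     brownian_motion M Fi B \<and>
     (\<forall>t\<ge>0. X t \<in> borel_measurable (Fi t)) \<and>
     (\<forall>\<omega>\<in>space M. X 0 \<omega> = x \<and> continuous_on {0..} (\<lambda>t. X t \<omega>) \<and> (\<forall>t\<ge>0. X t \<omega> \<in> I)) \<and>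
     (\<forall>t\<ge>0. ito_integral M (\<lambda>s \<omega>. v (X s \<omega>)) B t
              (\<lambda>\<omega>. X t \<omega> - x - integral {0..t} (\<lambda>s. m (X s \<omega>))))"


section \<open>The four diffusions\<close>

text \<open>Parameters: \<open>BM_Drift \<mu> \<sigma>\<close>, \<open>Ornstein_Uhlenbeck \<rho>\<close>, \<open>Square_Root \<rho>\<close>,
  \<open>Geometric_BM \<mu> \<sigma> d\<close>, where \<open>d\<close> is the ruin level.\<close>

datatype diffusion =
    BM_Drift real real
  | Ornstein_Uhlenbeck real
  | Square_Root real
  | Geometric_BM real real real

fun admissible :: "diffusion \<Rightarrow> bool" where
  "admissible (BM_Drift \<mu> \<sigma>) \<longleftrightarrow> 0 < \<mu> \<and> 0 < \<sigma>"
| "admissible (Ornstein_Uhlenbeck \<rho>) \<longleftrightarrow> 0 < \<rho>"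
| "admissible (Square_Root \<rho>) \<longleftrightarrow> 0 < \<rho>"
| "admissible (Geometric_BM \<mu> \<sigma> d) \<longleftrightarrow> \<sigma> \<noteq> 0 \<and> 0 < d"

fun drift :: "diffusion \<Rightarrow> real \<Rightarrow> real" where
  "drift (BM_Drift \<mu> \<sigma>) x = \<mu>"
| "drift (Ornstein_Uhlenbeck \<rho>) x = - \<rho> * x"
| "drift (Square_Root \<rho>) x = 1 - 2 * \<rho> * x"
| "drift (Geometric_BM \<mu> \<sigma> d) x = \<mu> * x"

fun volatility :: "diffusion \<Rightarrow> real \<Rightarrow> real" where
  "volatility (BM_Drift \<mu> \<sigma>) x = \<sigma>"
| "volatility (Ornstein_Uhlenbeck \<rho>) x = 1"
| "volatility (Square_Root \<rho>) x = 2 * sqrt x"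
| "volatility (Geometric_BM \<mu> \<sigma> d) x = \<sigma> * x"

text \<open>The interval in which the diffusion lives when it is not stopped at ruin.\<close>

fun natural_interval :: "diffusion \<Rightarrow> real set" where
  "natural_interval (BM_Drift \<mu> \<sigma>) = UNIV"
| "natural_interval (Ornstein_Uhlenbeck \<rho>) = UNIV"
| "natural_interval (Square_Root \<rho>) = {0..}"
| "natural_interval (Geometric_BM \<mu> \<sigma> d) = {0<..}"

fun ruin_level :: "diffusion \<Rightarrow> real" where
  "ruin_level (BM_Drift \<mu> \<sigma>) = 0"
| "ruin_level (Ornstein_Uhlenbeck \<rho>) = 0"
| "ruin_level (Square_Root \<rho>) = 0"
| "ruin_level (Geometric_BM \<mu> \<sigma> d) = d"


section \<open>Generator and fundamental solutions\<close>

definition generator :: "diffusion \<Rightarrow> (real \<Rightarrow> real) \<Rightarrow> real \<Rightarrow> real" where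
  "generator D u x = (volatility D x)\<^sup>2 / 2 * deriv (deriv u) x + drift D x * deriv u x"

definition positive_solution :: "diffusion \<Rightarrow> real \<Rightarrow> (real \<Rightarrow> real) \<Rightarrow> bool" where
  "positive_solution D \<alpha> u \<longleftrightarrow>
     continuous_on (natural_interval D) u \<and>
     (\<forall>x\<in>natural_interval D. 0 < u x) \<and>
     (\<forall>x\<in>interior (natural_interval D).
        u field_differentiable (at x) \<and> deriv u field_differentiable (at x) \<and>
        generator D u x - \<alpha> * u x = 0)"

text \<open>The equation is imposed on the whole natural interval, not just above the ruin level: on
  \<open>[ruin_level D, \<infinity>)\<close> alone the increasing solution would not be unique up to a factor. For
  \<open>Square_Root\<close>, where \<open>0\<close> is a regular boundary, no boundary condition at \<open>0\<close> is imposed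
  on \<open>\<psi>\<close>, so that every positive increasing solution is covered.\<close>

definition fundamental_solutions ::
  "diffusion \<Rightarrow> real \<Rightarrow> (real \<Rightarrow> real) \<Rightarrow> (real \<Rightarrow> real) \<Rightarrow> bool" where
  "fundamental_solutions D \<alpha> \<psi> \<phi> \<longleftrightarrow>
     positive_solution D \<alpha> \<psi> \<and> strict_mono_on (natural_interval D) \<psi> \<and>
     positive_solution D \<alpha> \<phi> \<and> monotone_on (natural_interval D) (<) (>) \<phi>"


section \<open>Ruin time, survival probability and reward\<close>

definition ruin_time :: "real \<Rightarrow> (real \<Rightarrow> 'w \<Rightarrow> real) \<Rightarrow> 'w \<Rightarrow> ereal" where
  "ruin_time l X \<omega> = Inf (ereal ` {t. 0 \<le> t \<and> X t \<omega> \<le> l})"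

text \<open>In the next two definitions \<open>M x\<close> plays the role of the law given \<open>X 0 = x\<close>, and \<open>X x\<close> is the
  diffusion started at \<open>x\<close>.\<close>

definition survival_prob ::
  "(real \<Rightarrow> 'w measure) \<Rightarrow> (real \<Rightarrow> real \<Rightarrow> 'w \<Rightarrow> real) \<Rightarrow> real \<Rightarrow> real \<Rightarrow> real \<Rightarrow> real" where
  "survival_prob M X l \<Delta> x =
     measure (M x) {\<omega> \<in> space (M x). ereal \<Delta> < ruin_time l (X x) \<omega>}"

definition reward ::
  "(real \<Rightarrow> 'w measure) \<Rightarrow> (real \<Rightarrow> real \<Rightarrow> 'w \<Rightarrow> real) \<Rightarrow> real \<Rightarrow> real \<Rightarrow>
   real \<Rightarrow> real \<Rightarrow> real \<Rightarrow> real \<Rightarrow> real \<Rightarrow> real" where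
  "reward M X l \<Delta> \<alpha> cost P x a =
     (\<integral>\<omega>. indicator {\<omega>. ereal \<Delta> < ruin_time l (X x) \<omega>} \<omega> * (X x \<Delta> \<omega> - a - cost) \<partial>M x)
     - exp (\<alpha> * \<Delta>) * P *
       (\<integral>\<omega>. indicator {\<omega>. ruin_time l (X x) \<omega> < ereal \<Delta>} \<omega> *
          exp (- \<alpha> * real_of_ereal (ruin_time l (X x) \<omega>)) \<partial>M x)"

end

theory Submission
  imports Defs
begin

text \<open>The formulas of both branches of \<open>W\<close> are differentiable at \<open>F b\<close>, and the hypothesis on \<open>b\<close> says
  that both derivatives are \<open>\<beta>\<close>. The point is that the branches agree at \<open>F b\<close>: this is the defining
  equation of \<open>\<beta>\<close>, provided its denominator is nonzero (division by \<open>0\<close> would give \<open>\<beta> = 0\<close>). Now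
  \<open>g = \<psi> - F l * \<phi>\<close> vanishes at \<open>l\<close> and is strictly increasing, and the denominator times \<open>\<phi> b\<close> is
  \<open>g b - exp (- \<alpha> * \<Delta>) * h b * g a\<close>, which is positive since \<open>exp (- \<alpha> * \<Delta>)\<close> and the probability
  \<open>h b\<close> are at most \<open>1\<close>.\<close>

text \<open>The properties of \<open>\<psi>\<close> and \<open>\<phi>\<close> are given on the
  natural interval only. In the geometric case the inclusion rests on \<open>0 < d\<close>.\<close>

lemma atLeast_ruin_level_subset_natural_interval:
  assumes "admissible D"
  shows "{ruin_level D..} \<subseteq> natural_interval D"
  using assms by (cases D) auto

lemma fundamental_solutions_pos:
  assumes "fundamental_solutions D \<alpha> \<psi> \<phi>" "x \<in> natural_interval D"
  shows "0 < \<psi> x" "0 < \<phi> x"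
  using assms by (auto simp: fundamental_solutions_def positive_solution_def)

lemma fundamental_solutions_less:
  assumes "fundamental_solutions D \<alpha> \<psi> \<phi>"
    and "x \<in> natural_interval D" "y \<in> natural_interval D" "x < y"
  shows "\<psi> x < \<psi> y" "\<phi> y < \<phi> x"
  using assms by (auto simp: fundamental_solutions_def monotone_on_def)

lemma fundamental_solutions_quotient_less:
  assumes "fundamental_solutions D \<alpha> \<psi> \<phi>"
    and "x \<in> natural_interval D" "y \<in> natural_interval D" "x < y"
  shows "\<psi> x / \<phi> x < \<psi> y / \<phi> y"
proof (rule frac_less)
  show "0 \<le> \<psi> x" "0 < \<phi> y"
    using fundamental_solutions_pos[OF assms(1)] assms(2,3) by (auto intro: less_imp_le)
  show "\<psi> x < \<psi> y" "\<phi> y \<le> \<phi> x"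
    using fundamental_solutions_less[OF assms] by auto
qed

lemma survival_prob_nonneg: "0 \<le> survival_prob M X l \<Delta> x"
  by (simp add: survival_prob_def)

lemma survival_prob_le_1:
  assumes "prob_space (M x)"
  shows "survival_prob M X l \<Delta> x \<le> 1"
  unfolding survival_prob_def by (rule prob_space.prob_le_1[OF assms])

text \<open>Shaped after the denominator of \<open>\<beta>\<close>: \<open>c\<close> stands for
  \<open>exp (- \<alpha> * \<Delta>) * h b\<close>, and the separate factor
  \<open>1 / \<phi> b\<close> is what then remains of
  \<open>H (F b) = h b / \<phi> b\<close>.\<close>

lemma denominator_pos:
  fixes \<psi> \<phi> :: "real \<Rightarrow> real"
  assumes sol: "fundamental_solutions D \<alpha> \<psi> \<phi>" and sub: "{l..} \<subseteq> natural_interval D"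
    and ab: "l \<le> a" "a < b" and c: "0 \<le> c" "c \<le> 1"
  shows "0 < \<psi> b / \<phi> b - \<psi> l / \<phi> l - c * (\<psi> a / \<phi> a - \<psi> l / \<phi> l) * (1 / \<phi> b) * \<phi> a"
proof -
  have mem: "l \<in> natural_interval D" "a \<in> natural_interval D" "b \<in> natural_interval D"
    using sub ab by auto
  note pos = fundamental_solutions_pos[OF sol]
  define k where "k = \<psi> l / \<phi> l"
  define g where "g x = \<psi> x - k * \<phi> x" for x
  \<comment> \<open>Since \<open>\<phi>\<close> decreases, positivity of \<open>k\<close> makes
    \<open>- k * \<phi>\<close>, and with it \<open>g\<close>, strictly increasing.\<close>
  have "0 < k"
    using pos mem by (simp add: k_def)
  \<comment> \<open>As \<open>g x = \<phi> x * (\<psi> x / \<phi> x - k)\<close>, the sign of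
    \<open>g a\<close> is that of \<open>\<psi> a / \<phi> a - k\<close>.\<close>
  have "k \<le> \<psi> a / \<phi> a"
    using fundamental_solutions_quotient_less[OF sol mem(1,2)] ab
    by (cases "l = a") (auto simp: k_def intro: less_imp_le)
  then have "0 \<le> g a"
    using pos(2)[OF mem(2)] by (simp add: g_def field_simps)
  then have "c * g a \<le> g a"
    using c by (simp add: mult_left_le_one_le)
  also have "g a < g b"
    using fundamental_solutions_less[OF sol mem(2,3) ab(2)] mult_strict_left_mono[OF _ \<open>0 < k\<close>]
    by (fastforce simp: g_def intro: diff_strict_mono)
  finally have "0 < (g b - c * g a) / \<phi> b"
    using pos(2)[OF mem(3)] by simp
  also have "(g b - c * g a) / \<phi> b = \<psi> b / \<phi> b - k - c * (\<psi> a / \<phi> a - k) * (1 / \<phi> b) * \<phi> a"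
    using pos(2)[OF mem(2)] pos(2)[OF mem(3)] by (simp add: g_def field_simps)
  finally show ?thesis
    by (simp add: k_def)
qed

theorem mainTheorem2:
  fixes D :: diffusion
    and M :: "real \<Rightarrow> 'w measure"
    and Fi :: "real \<Rightarrow> real \<Rightarrow> 'w measure"
    and B X :: "real \<Rightarrow> real \<Rightarrow> 'w \<Rightarrow> real"
    and \<alpha> \<Delta> cost P l a b \<beta> \<xi> dR dH :: real
    and \<psi> \<phi> F Finv h H W :: "real \<Rightarrow> real"
    and r R :: "real \<Rightarrow> real \<Rightarrow> real"
  assumes "admissible D"
    and "l = ruin_level D"
    and "\<And>x. l \<le> x \<Longrightarrow>
           sde_solution (natural_interval D) (drift D) (volatility D) x (M x) (Fi x) (B x) (X x)"
    and "0 < \<alpha>" and "0 \<le> \<Delta>" and "0 < cost" and "0 \<le> P"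
    and "(\<nexists>\<rho>. D = Ornstein_Uhlenbeck \<rho>) \<Longrightarrow> P = 0"
    and "fundamental_solutions D \<alpha> \<psi> \<phi>"
    and "F = (\<lambda>x. \<psi> x / \<phi> x)"
    and "Finv = inv_into {l..} F"
    and "h = survival_prob M X l \<Delta>"
    and "r = reward M X l \<Delta> \<alpha> cost P"
    and "R = (\<lambda>y a. r (Finv y) a / \<phi> (Finv y))"
    and "H = (\<lambda>y. h (Finv y) / \<phi> (Finv y))"
    and "l \<le> a" and "a < b"
    and "\<beta> = (P / \<phi> l + exp (- \<alpha> * \<Delta>) * (R (F b) a - H (F b) * \<phi> a * (P / \<phi> l))) /
             (F b - F l - exp (- \<alpha> * \<Delta>) * (F a - F l) * H (F b) * \<phi> a)"
    and "\<xi> = - \<beta> * F l - P / \<phi> l"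
    and "\<And>y. F l \<le> y \<Longrightarrow> y \<le> F b \<Longrightarrow> W y = \<beta> * y + \<xi>"
    and "\<And>y. F b < y \<Longrightarrow> W y = exp (- \<alpha> * \<Delta>) * (W (F a) * \<phi> a * H y + R y a)"
    and "((\<lambda>y. R y a) has_real_derivative dR) (at (F b))"
    and "(H has_real_derivative dH) (at (F b))"
    and "\<beta> = exp (- \<alpha> * \<Delta>) * (dR + dH * \<phi> a * (\<beta> * (F a - F l) - P / \<phi> l))"
  shows "(W has_real_derivative \<beta>) (at_left (F b)) \<and>
         (W has_real_derivative \<beta>) (at_right (F b))"
proof -
  have sub: "{l..} \<subseteq> natural_interval D"
    using atLeast_ruin_level_subset_natural_interval[OF \<open>admissible D\<close>] \<open>l = ruin_level D\<close> by simp
  note sol = \<open>fundamental_solutions D \<alpha> \<psi> \<phi>\<close>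
  have less: "F x < F y" if "l \<le> x" "x < y" for x y
    unfolding \<open>F = _\<close>
    using fundamental_solutions_quotient_less[OF sol] sub that by (auto simp: subset_iff)
  have Fla: "F l \<le> F a"
    using less[of l a] \<open>l \<le> a\<close> by (cases "l = a") auto
  have Fab: "F a < F b"
    using less \<open>l \<le> a\<close> \<open>a < b\<close> by blast
  have Flb: "F l < F b"
    using Fla Fab by linarith
  have "strict_mono_on {l..} F"
    by (rule strict_mono_onI) (use less in auto)
  then have Finv: "Finv (F b) = b"
    unfolding \<open>Finv = _\<close> using \<open>l \<le> a\<close> \<open>a < b\<close> by (intro inv_into_f_f strict_mono_on_imp_inj_on) auto
  have Hb: "H (F b) = h b / \<phi> b"
    unfolding \<open>H = _\<close> by (simp only: Finv)
  have "prob_space (M b)"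
    using assms(3)[of b] \<open>l \<le> a\<close> \<open>a < b\<close> by (auto simp: sde_solution_def brownian_motion_def)
  then have h: "0 \<le> h b" "h b \<le> 1"
    unfolding \<open>h = _\<close> by (simp_all add: survival_prob_nonneg survival_prob_le_1)
  define e where "e = exp (- \<alpha> * \<Delta>)"
  have e: "0 \<le> e" "e \<le> 1"
    using \<open>0 < \<alpha>\<close> \<open>0 \<le> \<Delta>\<close> by (auto simp: e_def)
  have "0 < F b - F l - e * h b * (F a - F l) * (1 / \<phi> b) * \<phi> a"
    unfolding \<open>F = _\<close>
    using denominator_pos[OF sol sub \<open>l \<le> a\<close> \<open>a < b\<close>, of "e * h b"] e h
    by (simp add: mult_le_one)
  then have den: "F b - F l - e * (F a - F l) * H (F b) * \<phi> a \<noteq> 0"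
    unfolding Hb by (simp add: mult_ac)

  \<comment> \<open>\<open>F a\<close> lies on the affine piece, so \<open>W (F a)\<close> is the
    explicit constant \<open>V\<close> and the formula for \<open>W\<close> beyond
    \<open>F b\<close> no longer refers to \<open>W\<close>.\<close>
  define V where "V = \<beta> * (F a - F l) - P / \<phi> l"
  have WFa: "W (F a) = V"
    using assms(20)[OF Fla] Fab \<open>\<xi> = _\<close> by (simp add: V_def algebra_simps)
  have WFb: "W (F b) = \<beta> * F b + \<xi>"
    using assms(20)[OF less_imp_le[OF Flb]] by simp
  \<comment> \<open>The definition of \<open>\<beta>\<close> with its denominator cleared. Moving
    the terms in \<open>\<beta> * (F a - F l)\<close> to the right turns it into the agreement of
    the two branches at \<open>F b\<close>.\<close>
  have "\<beta> * (F b - F l - e * (F a - F l) * H (F b) * \<phi> a) =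
      P / \<phi> l + e * (R (F b) a - H (F b) * \<phi> a * (P / \<phi> l))"
    using den assms(18) unfolding e_def by (metis nonzero_eq_divide_eq)
  then have cont: "W (F b) = e * (V * \<phi> a * H (F b) + R (F b) a)"
    unfolding WFb \<open>\<xi> = _\<close> V_def by (simp add: algebra_simps)

  have "((\<lambda>y. \<beta> * y + \<xi>) has_real_derivative \<beta>) (at_left (F b))"
    by (auto intro!: derivative_eq_intros)
  moreover have "\<forall>\<^sub>F y in at_left (F b). \<beta> * y + \<xi> = W y"
    using eventually_at_left_real[OF Flb] by eventually_elim (simp add: assms(20))
  ultimately have left: "(W has_real_derivative \<beta>) (at_left (F b))"
    using WFb by (auto intro: has_field_derivative_cong_eventually[THEN iffD1])

  have "((\<lambda>y. e * (V * \<phi> a * H y + R y a)) has_real_derivative e * (V * \<phi> a * dH + dR))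
      (at_right (F b))"
    by (rule has_field_derivative_at_within)
      (intro DERIV_cmult DERIV_add assms(22,23))
  \<comment> \<open>Exactly the hypothesis on \<open>b\<close>.\<close>
  moreover have "e * (V * \<phi> a * dH + dR) = \<beta>"
    using assms(24) by (simp add: e_def V_def mult_ac add_ac)
  moreover have "\<forall>\<^sub>F y in at_right (F b). e * (V * \<phi> a * H y + R y a) = W y"
    by (rule eventually_at_rightI[of "F b" "F b + 1"]) (auto simp: assms(21) WFa e_def)
  \<comment> \<open>The filter \<open>at_right\<close> omits \<open>F b\<close>, where
    \<open>W\<close> is given by the affine branch. Difference quotients still start from
    \<open>W (F b)\<close>, so \<open>cont\<close> is needed to replace \<open>W\<close> by the
    right-hand formula.\<close>
  ultimately have right: "(W has_real_derivative \<beta>) (at_right (F b))"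
    using cont by (auto intro: has_field_derivative_cong_eventually[THEN iffD1])

  show ?thesis
    using left right by blast
qed

end
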